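(* Let $I,\mathcal{E}$ be the visible set and the labyrinth, and let the data $\pi_I$, $P_{I\times I}$, $P_{I\times\mathcal{E}}$, $P_{\mathcal{E}\times I}=\mathbf{1}_{\mathcal{E}}\pi_I^t$ and $\pi_{\mathcal{E}}$ be fixed as in the context. Let $\mathcal{C}$ be the set of all nonnegative matrices $P_{\mathcal{E}\times\mathcal{E}}=(P(d,e):d,e\in\mathcal{E})$ satisfying the two constraints $$P_{\mathcal{E}\times\mathcal{E}}\mathbf{1}_{\mathcal{E}}=\pi(\mathcal{E})\mathbf{1}_{\mathcal{E}}\qquad\text{and}\qquad \pi_{\mathcal{E}}^tP_{\mathcal{E}\times\mathcal{E}}=\pi(\mathcal{E})\,\pi_{\mathcal{E}}^t$$ (and no other constraint). Then the maximum entropy completion of the chain, i.e. the element of $\mathcal{C}$ at which the entropy $h(X)$ of the completed stationary chain is maximal over $\mathcal{C}$, is $$P_{\mathcal{E}\times\mathcal{E}}=\mathbf{1}_{\mathcal{E}}\,\pi_{\mathcal{E}}^t,$$ that is, $P(d,e)=\pi(e)$ for all $d,e\in\mathcal{E}$.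
   Context: Setting. $I$ and $\mathcal{E}$ are disjoint nonempty finite sets. $X=(X_n:n\in\mathbb{Z})$ is an irreducible stationary Markov chain on $I\sqcup\mathcal{E}$ with transition matrix $P=(P(a,b):a,b\in I\sqcup\mathcal{E})$ and stationary distribution $\pi$, $\pi^tP=\pi^t$ (so $\pi>0$). For $J,K\subseteq I\sqcup\mathcal{E}$, $P_{J\times K}=(P(a,b):a\in J,b\in K)$; $\pi_I,\pi_{\mathcal{E}}$ are the restrictions of $\pi$ to $I$ and $\mathcal{E}$; $\pi(A)=\sum_{a\in A}\pi(a)$; $\mathbf{1}_{\mathcal{E}}$ is the column vector of ones indexed by $\mathcal{E}$; vectors are columns. The matrix $P_{I\times I}$ is irreducible, and there is some $i\in I$ with $P(i,\mathcal{E})=\sum_{d\in\mathcal{E}}P(i,d)>0$. Hypotheses on the chain: (i) $P_{\mathcal{E}\times I}=\mathbf{1}_{\mathcal{E}}\pi_I^t$, i.e. $P(d,i)=\pi(i)$ for $d\in\mathcal{E}$, $i\in I$; (ii) $\pi(\mathcal{E})\pi_{\mathcal{E}}^t=\pi_{\mathcal{E}}^tP_{\mathcal{E}\times\mathcal{E}}$. These imply $P_{\mathcal{E}\times\mathcal{E}}\mathbf{1}_{\mathcal{E}}=\pi(\mathcal{E})\mathbf{1}_{\mathcal{E}}$ and $\pi_{\mathcal{E}}^t=\pi(I)^{-1}\pi_I^tP_{I\times\mathcal{E}}$. The quantities $\pi_I$, $P_{I\times I}$, $P_{I\times\mathcal{E}}$, $P_{\mathcal{E}\times I}$ (hence $\pi_{\mathcal{E}}$)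 are known and fixed, while the block $P_{\mathcal{E}\times\mathcal{E}}$ is unknown; a completion is a choice of this block, for which $\pi=(\pi_I,\pi_{\mathcal{E}})$ is stationary for the completed matrix. The entropy of the completed stationary chain is $$h(X)=-\sum_{a\in I\sqcup\mathcal{E}}\pi(a)\sum_{b\in I\sqcup\mathcal{E}}P(a,b)\log P(a,b),$$ with $0\log 0=0$. *)

theory Defs
  imports "HOL-Analysis.Analysis"
begin

text \<open>
  The visible set and the labyrinth are finite types \<open>'i\<close> and \<open>'e\<close>; the state space is
  their disjoint sum \<open>'i + 'e\<close>. The entry of \<open>P\<close> in row \<open>a\<close> and column \<open>b\<close> is \<open>P $ a $ b\<close>,
  and \<open>1 :: real ^ 'n\<close> is the vector of ones.
\<close>

definition vec_I :: "real ^ ('i::finite + 'e::finite) \<Rightarrow> real ^ 'i"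
  where "vec_I v = (\<chi> i. v $ Inl i)"

definition vec_E :: "real ^ ('i::finite + 'e::finite) \<Rightarrow> real ^ 'e"
  where "vec_E v = (\<chi> e. v $ Inr e)"

definition block_II :: "real ^ ('i::finite + 'e::finite) ^ ('i + 'e) \<Rightarrow> real ^ 'i ^ 'i"
  where "block_II P = (\<chi> i j. P $ Inl i $ Inl j)"

definition block_IE :: "real ^ ('i::finite + 'e::finite) ^ ('i + 'e) \<Rightarrow> real ^ 'e ^ 'i"
  where "block_IE P = (\<chi> i e. P $ Inl i $ Inr e)"

definition block_EI :: "real ^ ('i::finite + 'e::finite) ^ ('i + 'e) \<Rightarrow> real ^ 'i ^ 'e"
  where "block_EI P = (\<chi> d i. P $ Inr d $ Inl i)"

definition block_EE :: "real ^ ('i::finite + 'e::finite) ^ ('i + 'e) \<Rightarrow> real ^ 'e ^ 'e"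
  where "block_EE P = (\<chi> d e. P $ Inr d $ Inr e)"

definition outer :: "real ^ 'm \<Rightarrow> real ^ 'n \<Rightarrow> real ^ 'n ^ 'm"
  where "outer u v = (\<chi> i j. u $ i * v $ j)"

definition mass :: "real ^ ('n::finite) \<Rightarrow> real"
  where "mass v = (\<Sum>a\<in>UNIV. v $ a)"

text \<open>
  The infix \<open>^\<close> would be the entrywise power on \<open>real ^ 'n ^ 'n\<close>. The exponent \<open>0\<close> is
  allowed below, so every \<open>1 \<times> 1\<close> matrix is irreducible; for larger nonnegative matrices
  this agrees with the convention that demands a positive exponent.
\<close>

definition mat_power :: "real ^ 'n ^ 'n \<Rightarrow> nat \<Rightarrow> real ^ 'n ^ ('n::finite)"
  where "mat_power A n = ((\<lambda>B. A ** B) ^^ n) (mat 1)"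

definition irreducible_matrix :: "real ^ 'n ^ ('n::finite) \<Rightarrow> bool"
  where "irreducible_matrix A \<longleftrightarrow> (\<forall>a b. \<exists>n. mat_power A n $ a $ b > 0)"

definition nonneg_matrix :: "real ^ 'n ^ 'm \<Rightarrow> bool"
  where "nonneg_matrix A \<longleftrightarrow> (\<forall>a b. 0 \<le> A $ a $ b)"

definition stochastic_matrix :: "real ^ 'n ^ ('n::finite) \<Rightarrow> bool"
  where "stochastic_matrix P \<longleftrightarrow> nonneg_matrix P \<and> P *v 1 = 1"

definition stationary_distribution :: "real ^ 'n \<Rightarrow> real ^ 'n ^ ('n::finite) \<Rightarrow> bool"
  where "stationary_distribution \<pi> P \<longleftrightarrow> (\<forall>a. 0 \<le> \<pi> $ a) \<and> mass \<pi> = 1 \<and> \<pi> v* P = \<pi>"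

text \<open>The term \<open>0 log 0\<close> is \<open>0\<close> here because of the factor \<open>P $ a $ b\<close>.\<close>

definition chain_entropy :: "real ^ 'n \<Rightarrow> real ^ 'n ^ ('n::finite) \<Rightarrow> real"
  where "chain_entropy \<pi> P = - (\<Sum>a\<in>UNIV. \<pi> $ a * (\<Sum>b\<in>UNIV. P $ a $ b * ln (P $ a $ b)))"

definition completed_matrix :: "real ^ ('i::finite + 'e::finite) ^ ('i + 'e) \<Rightarrow>
    real ^ 'e ^ 'e \<Rightarrow> real ^ ('i + 'e) ^ ('i + 'e)"
  where "completed_matrix P Q = (\<chi> a b. case a of
      Inl i \<Rightarrow> P $ a $ b
    | Inr d \<Rightarrow> (case b of Inl j \<Rightarrow> P $ a $ b | Inr e \<Rightarrow> Q $ d $ e))"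

definition completions :: "real ^ ('i::finite + 'e::finite) \<Rightarrow> (real ^ 'e ^ 'e) set"
  where "completions \<pi> = {Q. nonneg_matrix Q \<and>
    Q *v 1 = mass (vec_E \<pi>) *s 1 \<and>
    vec_E \<pi> v* Q = mass (vec_E \<pi>) *s vec_E \<pi>}"

end

theory Submission
  imports Defs
begin

text \<open>
  Only the rows of \<open>P\<close> indexed by the labyrinth contribute a varying term to the entropy. As both
  the row sums and \<open>\<pi>\<^sub>E\<^sup>t Q\<close> are prescribed, the cross entropy
  \<open>- (\<Sum>d e. \<pi> d * Q d e * ln (\<pi> e))\<close> is the same for all completions \<open>Q\<close>, so the entropy
  at \<open>\<one> \<pi>\<^sub>E\<^sup>t\<close> exceeds that at \<open>Q\<close> by the relative entropy
  \<open>\<Sum>d e. \<pi> d * (Q d e * ln (Q d e / \<pi> e))\<close>. By Gibbs' inequality, and because irreducibility makes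
  \<open>\<pi>\<close> positive, this is nonnegative and vanishes only if \<open>Q d e = \<pi> e\<close> throughout.
\<close>

lemma sum_UNIV_Plus:
  fixes f :: "'a::finite + 'b::finite \<Rightarrow> 'c::comm_monoid_add"
  shows "(\<Sum>a\<in>UNIV. f a) = (\<Sum>i\<in>UNIV. f (Inl i)) + (\<Sum>e\<in>UNIV. f (Inr e))"
  using sum.Plus[of "UNIV :: 'a set" "UNIV :: 'b set" f] by (simp add: comp_def)

lemma mat_power_nonneg:
  assumes "nonneg_matrix A"
  shows "nonneg_matrix (mat_power A n)"
proof (induction n)
  case 0
  show ?case by (simp add: mat_power_def nonneg_matrix_def mat_def)
next
  case (Suc n)
  then show ?case using assms
    by (auto simp: mat_power_def nonneg_matrix_def matrix_matrix_mult_def intro!: sum_nonneg)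
qed

lemma stationary_mat_power:
  assumes "\<pi> v* P = \<pi>"
  shows "\<pi> v* mat_power P n = \<pi>"
proof (induction n)
  case 0
  show ?case by (simp add: mat_power_def)
next
  case (Suc n)
  have "\<pi> v* mat_power P (Suc n) = (\<pi> v* P) v* mat_power P n"
    by (simp add: mat_power_def vector_matrix_mul_assoc)
  then show ?case using assms Suc by simp
qed

text \<open>A zero of \<pi> spreads: \<pi> is stationary under every power of \<open>P\<close>, so
  \<open>\<pi> $ b = 0\<close> is a vanishing sum of nonnegative terms. Hence \<pi> vanishes at each
  state leading to \<open>b\<close>, which by irreducibility is every state, against total mass
  1.\<close>

lemma stationary_distribution_pos:
  assumes "nonneg_matrix P" "stationary_distribution \<pi> P" "irreducible_matrix P"
  shows "0 < \<pi> $ b"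
proof (rule ccontr)
  assume "\<not> 0 < \<pi> $ b"
  moreover have nn: "0 \<le> \<pi> $ a" for a
    using assms(2) by (simp add: stationary_distribution_def)
  ultimately have b: "\<pi> $ b = 0" by (simp add: order_antisym)
  have "\<pi> $ a = 0" for a
  proof -
    obtain n where n: "mat_power P n $ a $ b > 0"
      using assms(3) by (auto simp: irreducible_matrix_def)
    have "(\<pi> v* mat_power P n) $ b = 0"
      using stationary_mat_power[of \<pi> P n] assms(2) b by (simp add: stationary_distribution_def)
    then have "(\<Sum>c\<in>UNIV. mat_power P n $ c $ b * \<pi> $ c) = 0"
      by (simp add: vector_matrix_mult_def mult.commute)
    moreover have "0 \<le> mat_power P n $ c $ b * \<pi> $ c" for c
      using mat_power_nonneg[OF assms(1), of n] nn by (simp add: nonneg_matrix_def)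
    ultimately have "mat_power P n $ a $ b * \<pi> $ a = 0"
      by (simp add: sum_nonneg_eq_0_iff)
    then show ?thesis using n by simp
  qed
  then show False using assms(2) by (simp add: stationary_distribution_def mass_def)
qed

text \<open>The summand of the relative entropy, with the terms \<open>- q + p\<close> making it nonnegative pointwise.\<close>

definition gibbs_gap :: "real \<Rightarrow> real \<Rightarrow> real"
  where "gibbs_gap q p = q * ln q - q * ln p - q + p"

lemma gibbs_gap_self [simp]: "gibbs_gap p p = 0"
  by (simp add: gibbs_gap_def)

text \<open>This is the strict form of \<open>ln x \<le> x - 1\<close> at \<open>x = p / q\<close>,
  multiplied by \<open>q\<close>. The case \<open>q = 0\<close> is separate; there the gap is just
  \<open>p\<close>.\<close>

lemma gibbs_gap_pos:
  assumes "0 \<le> q" "0 < p" "q \<noteq> p"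
  shows "0 < gibbs_gap q p"
proof (cases "q = 0")
  case True
  then show ?thesis using assms by (simp add: gibbs_gap_def)
next
  case False
  with assms have q: "0 < q" by simp
  have "ln (p / q) \<noteq> p / q - 1"
    using ln_eq_minus_one[of "p / q"] q assms by auto
  with ln_le_minus_one[of "p / q"] q assms have "ln (p / q) < p / q - 1" by simp
  then have "q * ln (p / q) < q * (p / q - 1)" using q by simp
  then show ?thesis using q assms by (simp add: gibbs_gap_def ln_div right_diff_distrib)
qed

lemma gibbs_gap_nonneg:
  assumes "0 \<le> q" "0 < p"
  shows "0 \<le> gibbs_gap q p"
  using gibbs_gap_pos[OF assms] by (cases "q = p") auto

lemma completions_iff:
  "Q \<in> completions \<pi> \<longleftrightarrow> nonneg_matrix Q \<and>
    (\<forall>d. (\<Sum>e\<in>UNIV. Q $ d $ e) = mass (vec_E \<pi>)) \<and>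
    (\<forall>e. (\<Sum>d\<in>UNIV. \<pi> $ Inr d * Q $ d $ e) = mass (vec_E \<pi>) * \<pi> $ Inr e)"
  by (simp add: completions_def vec_eq_iff matrix_vector_mult_def vector_matrix_mult_def vec_E_def
      mult.commute)

lemma outer_in_completions:
  assumes "\<And>e. 0 \<le> \<pi> $ Inr e"
  shows "outer 1 (vec_E \<pi>) \<in> completions \<pi>"
  using assms by (simp add: completions_iff outer_def nonneg_matrix_def vec_E_def mass_def
      flip: sum_distrib_right)

text \<open>The constant \<open>c\<close> absorbs the contributions of the three known blocks, so
  that comparing two completions only involves the labyrinth block.\<close>

lemma chain_entropy_completed:
  obtains c where "\<And>Q. chain_entropy \<pi> (completed_matrix P Q) =
    c - (\<Sum>d\<in>UNIV. \<pi> $ Inr d * (\<Sum>e\<in>UNIV. Q $ d $ e * ln (Q $ d $ e)))"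
proof
  let ?f = "\<lambda>a b. P $ a $ b * ln (P $ a $ b)"
  show "chain_entropy \<pi> (completed_matrix P Q) =
    - ((\<Sum>i\<in>UNIV. \<pi> $ Inl i * (\<Sum>b\<in>UNIV. ?f (Inl i) b)) +
       (\<Sum>d\<in>UNIV. \<pi> $ Inr d * (\<Sum>j\<in>UNIV. ?f (Inr d) (Inl j))))
    - (\<Sum>d\<in>UNIV. \<pi> $ Inr d * (\<Sum>e\<in>UNIV. Q $ d $ e * ln (Q $ d $ e)))" for Q
    by (simp add: chain_entropy_def completed_matrix_def sum_UNIV_Plus distrib_left sum.distrib)
qed

lemma sum_gibbs_gap_completion:
  assumes "Q \<in> completions \<pi>"
  shows "(\<Sum>d\<in>UNIV. \<Sum>e\<in>UNIV. \<pi> $ Inr d * gibbs_gap (Q $ d $ e) (\<pi> $ Inr e)) =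
    (\<Sum>d\<in>UNIV. \<pi> $ Inr d * (\<Sum>e\<in>UNIV. Q $ d $ e * ln (Q $ d $ e))) -
    mass (vec_E \<pi>) * (\<Sum>e\<in>UNIV. \<pi> $ Inr e * ln (\<pi> $ Inr e))"
proof -
  let ?m = "mass (vec_E \<pi>)"
  have row: "(\<Sum>e\<in>UNIV. Q $ d $ e) = ?m" for d
    using assms by (simp add: completions_iff)
  have col: "(\<Sum>d\<in>UNIV. \<pi> $ Inr d * Q $ d $ e) = ?m * \<pi> $ Inr e" for e
    using assms by (simp add: completions_iff)
  have m: "(\<Sum>e\<in>UNIV. \<pi> $ Inr e) = ?m" by (simp add: mass_def vec_E_def)
  \<comment> \<open>Swapping the sums exposes the column sums weighted by \<pi>, which the second
    constraint fixes; this removes \<open>Q\<close> from the cross term.\<close>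
  have "(\<Sum>d\<in>UNIV. \<pi> $ Inr d * (\<Sum>e\<in>UNIV. Q $ d $ e * ln (\<pi> $ Inr e))) =
      (\<Sum>e\<in>UNIV. (\<Sum>d\<in>UNIV. \<pi> $ Inr d * Q $ d $ e) * ln (\<pi> $ Inr e))"
    unfolding sum_distrib_left sum_distrib_right
    by (subst sum.swap) (simp add: mult.assoc)
  also have "\<dots> = ?m * (\<Sum>e\<in>UNIV. \<pi> $ Inr e * ln (\<pi> $ Inr e))"
    by (simp add: col sum_distrib_left mult.assoc)
  finally have cross: "(\<Sum>d\<in>UNIV. \<pi> $ Inr d * (\<Sum>e\<in>UNIV. Q $ d $ e * ln (\<pi> $ Inr e))) =
      ?m * (\<Sum>e\<in>UNIV. \<pi> $ Inr e * ln (\<pi> $ Inr e))" .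
  \<comment> \<open>The linear terms \<open>- q + p\<close> cancel along each row, since
    \<open>Q $ d\<close> and the labyrinth part of \<pi> have the same sum
    \<open>?m\<close>.\<close>
  have "(\<Sum>e\<in>UNIV. \<pi> $ Inr d * gibbs_gap (Q $ d $ e) (\<pi> $ Inr e)) =
      \<pi> $ Inr d * (\<Sum>e\<in>UNIV. Q $ d $ e * ln (Q $ d $ e)) -
      \<pi> $ Inr d * (\<Sum>e\<in>UNIV. Q $ d $ e * ln (\<pi> $ Inr e))" for d
    by (simp add: gibbs_gap_def sum.distrib sum_subtractf row m right_diff_distrib
        flip: sum_distrib_left)
  then show ?thesis by (simp add: sum_subtractf cross)
qed

lemma chain_entropy_gap:
  assumes "Q \<in> completions \<pi>" "\<And>e. 0 \<le> \<pi> $ Inr e"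
  shows "chain_entropy \<pi> (completed_matrix P (outer 1 (vec_E \<pi>))) =
    chain_entropy \<pi> (completed_matrix P Q) +
    (\<Sum>d\<in>UNIV. \<Sum>e\<in>UNIV. \<pi> $ Inr d * gibbs_gap (Q $ d $ e) (\<pi> $ Inr e))"
proof -
  obtain c where c: "\<And>Q. chain_entropy \<pi> (completed_matrix P Q) =
    c - (\<Sum>d\<in>UNIV. \<pi> $ Inr d * (\<Sum>e\<in>UNIV. Q $ d $ e * ln (Q $ d $ e)))"
    using chain_entropy_completed[of \<pi> P] by blast
  show ?thesis
    \<comment> \<open>The identity is used twice. For the rank-one completion every gap is zero,
      which evaluates its own entropy term; subtracting eliminates the common cross term.\<close>
    using sum_gibbs_gap_completion[OF assms(1)]
      sum_gibbs_gap_completion[OF outer_in_completions, of \<pi>, OF assms(2)]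
    unfolding c by (simp add: outer_def vec_E_def)
qed

theorem theorem3p1:
  fixes P :: "real ^ ('i::finite + 'e::finite) ^ ('i + 'e)"
    and \<pi> :: "real ^ ('i + 'e)"
  assumes "stochastic_matrix P"
    and "stationary_distribution \<pi> P"
    and "irreducible_matrix P"
    and "irreducible_matrix (block_II P)"
    and "\<exists>i. (\<Sum>d\<in>UNIV. block_IE P $ i $ d) > 0"
    and "block_EI P = outer 1 (vec_I \<pi>)"
    and "mass (vec_E \<pi>) *s vec_E \<pi> = vec_E \<pi> v* block_EE P"
  shows "{Q. is_arg_max (\<lambda>Q. chain_entropy \<pi> (completed_matrix P Q))
        (\<lambda>Q. Q \<in> completions \<pi>) Q} = {outer 1 (vec_E \<pi>)}"
proof -
  let ?O = "outer 1 (vec_E \<pi>) :: real ^ 'e ^ 'e"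
  let ?h = "\<lambda>Q. chain_entropy \<pi> (completed_matrix P Q)"
  have pos: "0 < \<pi> $ a" for a
    using stationary_distribution_pos assms by (auto simp: stochastic_matrix_def)
  have O: "?O \<in> completions \<pi>"
    using pos by (intro outer_in_completions less_imp_le)
  \<comment> \<open>Strictness yields maximality and uniqueness together. A single differing entry
    suffices: its gap is positive and so is its weight \<open>\<pi> $ Inr d\<close>, while all other
    terms are nonnegative.\<close>
  have less: "?h Q < ?h ?O" if Q: "Q \<in> completions \<pi>" and ne: "Q \<noteq> ?O" for Q
  proof -
    let ?g = "\<lambda>d e. \<pi> $ Inr d * gibbs_gap (Q $ d $ e) (\<pi> $ Inr e)"
    have Q0: "0 \<le> Q $ d $ e" for d e
      using Q by (simp add: completions_iff nonneg_matrix_def)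
    have g0: "0 \<le> ?g d e" for d e
      using pos Q0 by (intro mult_nonneg_nonneg gibbs_gap_nonneg) (auto intro: less_imp_le)
    obtain d e where de: "Q $ d $ e \<noteq> \<pi> $ Inr e"
      using ne by (auto simp: vec_eq_iff outer_def vec_E_def)
    have "0 < ?g d e"
      using pos Q0 de by (intro mult_pos_pos gibbs_gap_pos) auto
    then have "0 < (\<Sum>e\<in>UNIV. ?g d e)"
      using g0 by (intro sum_pos2[of UNIV e]) auto
    then have "0 < (\<Sum>d\<in>UNIV. \<Sum>e\<in>UNIV. ?g d e)"
      by (rule sum_pos2[of UNIV d, rotated 2]) (auto intro: sum_nonneg g0)
    then show ?thesis
      using chain_entropy_gap[OF Q, of P] pos by (simp add: less_imp_le)
  qed
  show ?thesis
    using O less unfolding is_arg_max_def by (auto dest: less_asym)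
qed

end
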